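(* Let $p$ be an odd prime, $H_m=\sum_{j=1}^m\frac1j$, $H'_{p-1}=1+\frac13+\dots+\frac1{p-2}$ and $q_p(2)=\frac{2^{p-1}-1}{p}$. Then $$\sum_{\substack{m=1\\ m\text{ odd}}}^{p-2}H_m\equiv\frac12\bigl(1+(H'_{p-1})_0\bigr)\equiv\frac{1+q_p(2)}{2}\pmod p.$$
   Context: $(H'_{p-1})_0\in\{0,\dots,p-1\}$ denotes the residue of $H'_{p-1}$ modulo $p$. Congruences are in $\mathbb{Z}_p$. *)

theory Defs
  imports "HOL-Number_Theory.Number_Theory"
begin

text \<open>All numbers involved are rational, so the ring of \<open>p\<close>-adic integers enters only through its
  rational elements: those whose denominator in lowest terms is prime to \<open>p\<close>. On these,
  congruence modulo \<open>p\<close> in \<open>Z_p\<close> means that the difference is \<open>p\<close> times a \<open>p\<close>-adic integer; the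
  cofactor is then automatically rational. The congruence is only allowed to hold between
  elements of \<open>Z_p\<close>, so \<open>p\<close>-integrality of both sides is part of what it asserts.\<close>

definition padic_integral :: "nat \<Rightarrow> rat \<Rightarrow> bool" where
  "padic_integral p x \<longleftrightarrow> \<not> int p dvd snd (quotient_of x)"

definition padic_cong :: "nat \<Rightarrow> rat \<Rightarrow> rat \<Rightarrow> bool" where
  "padic_cong p x y \<longleftrightarrow> padic_integral p x \<and> padic_integral p y \<and>
     (\<exists>z. padic_integral p z \<and> x - y = of_nat p * z)"

definition padic_residue :: "nat \<Rightarrow> rat \<Rightarrow> nat" where
  "padic_residue p x = (THE r. r \<in> {0..p - 1} \<and> padic_cong p x (of_nat r))"

text \<open>The library's \<open>harm\<close> is restricted to real normed fields, which excludes \<^typ>\<open>rat\<close>.\<close>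

definition harmonic :: "nat \<Rightarrow> rat" where
  "harmonic m = (\<Sum>j=1..m. 1 / of_nat j)"

definition odd_harmonic :: "nat \<Rightarrow> rat" where
  "odd_harmonic n = (\<Sum>j\<in>{j\<in>{1..n}. odd j}. 1 / of_nat j)"

definition fermat_quotient :: "nat \<Rightarrow> nat \<Rightarrow> rat" where
  "fermat_quotient p a = (of_nat a ^ (p - 1) - 1) / of_nat p"

lemma padic_integralI:
  assumes b: "\<not> int p dvd b" and x: "x = of_int a / of_int b"
  shows "padic_integral p x"
proof -
  obtain c d where cd: "quotient_of x = (c, d)" by (cases "quotient_of x")
  have d0: "d > 0" and cop: "coprime c d" and xc: "x = of_int c / of_int d"
    using cd quotient_of_denom_pos quotient_of_coprime quotient_of_div by blast+
  have b0: "b \<noteq> 0" using b by auto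
  have "(of_int (a * d) :: rat) = of_int (c * b)"
    using x xc d0 b0 by (simp add: field_simps)
  then have "a * d = c * b" by (simp only: of_int_eq_iff)
  then have "d dvd b"
    using cop by (metis coprime_commute coprime_dvd_mult_right_iff dvd_triv_right)
  then show ?thesis using b cd by (auto simp: padic_integral_def intro: dvd_trans)
qed

lemma padic_residue_ex1:
  assumes p: "prime p" and x: "padic_integral p x"
  shows "\<exists>!r. r \<in> {0..p - 1} \<and> padic_cong p x (of_nat r)"
proof -
  obtain a b where ab: "quotient_of x = (a, b)" by (cases "quotient_of x")
  have b0: "b > 0" and xa: "x = of_int a / of_int b"
    using ab quotient_of_denom_pos quotient_of_div by blast+
  have nb: "\<not> int p dvd b" using x ab by (simp add: padic_integral_def)
  have p0: "p > 0" using p prime_gt_0_nat by blast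
  have int_nat: "padic_integral p (of_nat r)" for r
    by (rule padic_integralI[of p 1 _ "int r"]) (use p in auto)
  have cong_iff: "padic_cong p x (of_nat r) \<longleftrightarrow> [b * int r = a] (mod int p)" for r
  proof
    assume "padic_cong p x (of_nat r)"
    then obtain z where z: "padic_integral p z" "x - of_nat r = of_nat p * z"
      by (auto simp: padic_cong_def)
    obtain c d where cd: "quotient_of z = (c, d)" by (cases "quotient_of z")
    have d0: "d > 0" and zc: "z = of_int c / of_int d"
      using cd quotient_of_denom_pos quotient_of_div by blast+
    have nd: "\<not> int p dvd d" using z cd by (simp add: padic_integral_def)
    have "(of_int ((a - b * int r) * d) :: rat) = of_int (int p * (c * b))"
      using z(2) xa zc b0 d0 by (simp add: field_simps)
    then have "(a - b * int r) * d = int p * (c * b)" by (simp only: of_int_eq_iff)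
    then have "int p dvd (a - b * int r) * d" by simp
    then have "int p dvd a - b * int r" using nd p by (auto simp: prime_dvd_mult_iff)
    then show "[b * int r = a] (mod int p)" by (simp add: cong_iff_dvd_diff dvd_diff_commute)
  next
    assume "[b * int r = a] (mod int p)"
    then have "int p dvd a - b * int r" by (simp add: cong_iff_dvd_diff dvd_diff_commute)
    then obtain k where "a - b * int r = int p * k" by (elim dvdE)
    then have a: "a = b * int r + int p * k" by simp
    have "x - of_nat r = of_nat p * (of_int k / of_int b)"
      using b0 xa by (simp add: a field_simps)
    then show "padic_cong p x (of_nat r)"
      unfolding padic_cong_def using x int_nat padic_integralI[OF nb] by blast
  qed
  have cop: "coprime b (int p)"
    using nb p by (metis coprime_commute prime_imp_coprime prime_nat_int_transfer)
  then obtain c where c: "[b * c = 1] (mod int p)" using cong_solve_coprime_int by blast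
  let ?r = "nat ((a * c) mod int p)"
  have "[b * ((a * c) mod int p) = a * (b * c)] (mod int p)"
    by (simp add: cong_def mod_mult_right_eq ac_simps)
  also have "[a * (b * c) = a * 1] (mod int p)" using c by (rule cong_scalar_left)
  finally have ex: "[b * int ?r = a] (mod int p)" using p0 by simp
  have "(a * c) mod int p < int p" using p0 by simp
  then have lt: "?r \<in> {0..p - 1}" using p0 by (auto simp: nat_less_iff less_Suc_eq_le[symmetric])
  show ?thesis
  proof (rule ex1I[of _ ?r])
    show "?r \<in> {0..p - 1} \<and> padic_cong p x (of_nat ?r)" using ex lt cong_iff by blast
  next
    fix s assume s: "s \<in> {0..p - 1} \<and> padic_cong p x (of_nat s)"
    then have "[b * int s = b * int ?r] (mod int p)"
      using ex cong_iff cong_sym cong_trans by blast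
    then have "[int s = int ?r] (mod int p)" using cop cong_mult_lcancel by blast
    then have "[s = ?r] (mod p)" by (simp only: cong_int_iff)
    moreover have "s < p" "?r < p" using s lt p0 by auto
    ultimately show "s = ?r" by (simp only: cong_less_modulus_unique_nat)
  qed
qed

end

theory Submission
  imports Defs
begin

text \<open>Write \<open>p = 2 n + 1\<close>, let \<open>H\<close> be the harmonic sum up to \<open>p - 1\<close>, and \<open>O\<close> its odd part. Exactly, the sum
  of \<open>H\<^sub>m\<close> over odd \<open>m < p\<close> equals \<open>n H - n + O / 2\<close>, and pairing \<open>j\<close> with \<open>p - j\<close> shows that \<open>p\<close>
  divides \<open>H\<close>, so the sum is congruent to \<open>(1 + O) / 2\<close>. Expanding \<open>2\<^sup>p = (1 + 1)\<^sup>p\<close> and using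
  \<open>(p choose j) / p = (p - 1 choose j - 1) / j\<close> with \<open>p - 1 choose j - 1\<close> congruent to \<open>(-1)^(j - 1)\<close>
  shows that twice the Fermat quotient is congruent to the alternating harmonic sum \<open>2 O - H\<close>,
  hence to \<open>2 O\<close>.\<close>

section \<open>Ring structure of the \<open>p\<close>-integral rationals\<close>

lemma padic_integralE:
  assumes "padic_integral p x"
  obtains a b where "\<not> int p dvd b" "b \<noteq> 0" "x = of_int a / of_int b"
proof -
  obtain a b where ab: "quotient_of x = (a, b)" by (cases "quotient_of x")
  show thesis
  proof
    show "\<not> int p dvd b" using assms ab by (simp add: padic_integral_def)
    then show "b \<noteq> 0" by auto
    show "x = of_int a / of_int b" using ab by (rule quotient_of_div)
  qed
qed

lemma padic_integral_of_int: "prime p \<Longrightarrow> padic_integral p (of_int k)"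
  by (rule padic_integralI[of p 1 _ k]) auto

lemma padic_integral_of_nat: "prime p \<Longrightarrow> padic_integral p (of_nat k)"
  using padic_integral_of_int[of p "int k"] by simp

lemma padic_integral_inverse_of_nat: "\<not> p dvd k \<Longrightarrow> padic_integral p (1 / of_nat k)"
  by (rule padic_integralI[of p "int k" _ 1]) auto

lemma padic_integral_add:
  assumes p: "prime p" and x: "padic_integral p x" and y: "padic_integral p y"
  shows "padic_integral p (x + y)"
proof -
  obtain a b where x': "\<not> int p dvd b" "b \<noteq> 0" "x = of_int a / of_int b"
    using x by (rule padic_integralE)
  obtain c d where y': "\<not> int p dvd d" "d \<noteq> 0" "y = of_int c / of_int d"
    using y by (rule padic_integralE)
  show ?thesis
  proof (rule padic_integralI)
    show "\<not> int p dvd b * d" using p x' y' by (simp add: prime_dvd_mult_iff)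
    show "x + y = of_int (a * d + c * b) / of_int (b * d)" using x' y' by (simp add: field_simps)
  qed
qed

lemma padic_integral_mult:
  assumes p: "prime p" and x: "padic_integral p x" and y: "padic_integral p y"
  shows "padic_integral p (x * y)"
proof -
  obtain a b where x': "\<not> int p dvd b" "b \<noteq> 0" "x = of_int a / of_int b"
    using x by (rule padic_integralE)
  obtain c d where y': "\<not> int p dvd d" "d \<noteq> 0" "y = of_int c / of_int d"
    using y by (rule padic_integralE)
  show ?thesis
  proof (rule padic_integralI)
    show "\<not> int p dvd b * d" using p x' y' by (simp add: prime_dvd_mult_iff)
    show "x * y = of_int (a * c) / of_int (b * d)" using x' y' by simp
  qed
qed

lemma padic_integral_diff:
  assumes "prime p" "padic_integral p x" "padic_integral p y"
  shows "padic_integral p (x - y)"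
  using padic_integral_add[OF assms(1,2) padic_integral_mult[OF assms(1)
      padic_integral_of_int[OF assms(1), of "-1"] assms(3)]] by simp

lemma padic_integral_sum:
  assumes "prime p" "\<And>i. i \<in> A \<Longrightarrow> padic_integral p (f i)"
  shows "padic_integral p (\<Sum>i\<in>A. f i)"
  using assms(2)
proof (induction A rule: infinite_finite_induct)
  case (insert i A)
  then show ?case by (simp add: padic_integral_add[OF assms(1)])
qed (use padic_integral_of_nat[OF assms(1), of 0] in simp_all)

text \<open>For odd \<open>p\<close> the number 2 is a unit of the \<open>p\<close>-integral
  rationals; every later halving rests on this.\<close>

lemma padic_integral_half:
  assumes "prime p" "odd p" "padic_integral p x"
  shows "padic_integral p (x / 2)"
proof -
  have "\<not> p dvd 2" using assms(1,2) primes_dvd_imp_eq[OF _ two_is_prime_nat, of p] by auto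
  from padic_integral_mult[OF assms(1,3) padic_integral_inverse_of_nat[OF this]]
  show ?thesis by simp
qed

section \<open>Congruence of rationals modulo \<open>p\<close>\<close>

lemma padic_congI:
  assumes p: "prime p" and y: "padic_integral p y" and z: "padic_integral p z"
    and "x - y = of_nat p * z"
  shows "padic_cong p x y"
proof -
  \<comment> \<open>Only one side has to be shown integral: the other is then \<open>y + p z\<close>
    with \<open>y\<close> and \<open>z\<close> integral.\<close>
  have "x = y + of_nat p * z" using assms(4) by simp
  then have "padic_integral p x"
    using padic_integral_add[OF p y padic_integral_mult[OF p padic_integral_of_nat[OF p] z]] by simp
  then show ?thesis using assms unfolding padic_cong_def by blast
qed

lemma padic_congE:
  assumes "padic_cong p x y"
  obtains z where "padic_integral p x" "padic_integral p y" "padic_integral p z"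
    "x - y = of_nat p * z"
  using assms unfolding padic_cong_def by blast

lemma padic_cong_trans:
  assumes p: "prime p" and "padic_cong p x y" "padic_cong p y z"
  shows "padic_cong p x z"
proof -
  obtain u where u: "padic_integral p u" "x - y = of_nat p * u"
    using assms(2) by (rule padic_congE)
  obtain v where v: "padic_integral p z" "padic_integral p v" "y - z = of_nat p * v"
    using assms(3) by (rule padic_congE)
  have "x - z = of_nat p * (u + v)" using u(2) v(3) by (simp add: algebra_simps)
  then show ?thesis using padic_congI[OF p v(1) padic_integral_add[OF p u(1) v(2)]] by blast
qed

lemma padic_cong_sym:
  assumes p: "prime p" and "padic_cong p x y"
  shows "padic_cong p y x"
proof -
  obtain u where u: "padic_integral p x" "padic_integral p u" "x - y = of_nat p * u"
    using assms(2) by (rule padic_congE)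
  have "y - x = of_nat p * (0 - u)" using u(3) by (simp add: algebra_simps)
  moreover have "padic_integral p (0 - u)"
    using padic_integral_diff[OF p padic_integral_of_nat[OF p, of 0] u(2)] by simp
  ultimately show ?thesis using padic_congI[OF p u(1)] by blast
qed

text \<open>All expressions compared in the theorem, apart from the sum itself, have the form
  \<open>(1 + x) / 2\<close>. This reduces their congruences to congruences between the values of
  \<open>x\<close>.\<close>

lemma padic_cong_half_Suc:
  assumes p: "prime p" "odd p" and "padic_cong p x y"
  shows "padic_cong p ((1 + x) / 2) ((1 + y) / 2)"
proof -
  obtain u where u: "padic_integral p y" "padic_integral p u" "x - y = of_nat p * u"
    using assms(3) by (rule padic_congE)
  have "(1 + x) / 2 - (1 + y) / 2 = (x - y) / 2" by (simp add: field_simps)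
  then have "(1 + x) / 2 - (1 + y) / 2 = of_nat p * (u / 2)" using u(3) by simp
  moreover have "padic_integral p ((1 + y) / 2)"
    using padic_integral_half[OF p padic_integral_add[OF p(1) padic_integral_of_nat[OF p(1), of 1] u(1)]]
    by simp
  ultimately show ?thesis using padic_congI[OF p(1) _ padic_integral_half[OF p u(2)]] by blast
qed

lemma padic_residue_cong:
  assumes "prime p" "padic_integral p x"
  shows "padic_cong p x (of_nat (padic_residue p x))"
  using theI'[OF padic_residue_ex1[OF assms]] unfolding padic_residue_def by blast

section \<open>Exact identities for harmonic sums\<close>

lemma harmonic_Suc: "harmonic (Suc m) = harmonic m + 1 / of_nat (Suc m)"
  by (simp add: harmonic_def)

lemma odd_harmonic_Suc:
  "odd_harmonic (Suc m) = odd_harmonic m + (if even m then 1 / of_nat (Suc m) else 0)"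
proof -
  have "{j \<in> {1..Suc m}. odd j} = {j \<in> {1..m}. odd j} \<union> (if even m then {Suc m} else {})"
    by (auto simp: le_Suc_eq)
  then show ?thesis by (simp add: odd_harmonic_def)
qed

text \<open>The term \<open>1 / j\<close> occurs once for each odd \<open>m\<close> with
  \<open>j \<le> m \<le> 2 n - 1\<close>, that is \<open>n - j div 2\<close> times. It contributes
  \<open>n / j - 1 / 2\<close>, and \<open>1 / (2 j)\<close> more if \<open>j\<close> is odd;
  summing over \<open>j \<le> 2 n\<close> gives the right-hand side. The proof verifies this by
  induction.\<close>

lemma sum_harmonic_odd:
  "(\<Sum>m\<in>{m\<in>{1..2 * n - 1}. odd m}. harmonic m)
     = of_nat n * harmonic (2 * n) - of_nat n + odd_harmonic (2 * n) / 2"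
proof (induction n)
  case 0
  show ?case by (simp add: odd_harmonic_def)
next
  case (Suc n)
  \<comment> \<open>For \<open>n = 0\<close> the bound \<open>2 * n - 1\<close> truncates to 0, so
    the smaller range is empty, as it should be.\<close>
  have "{m \<in> {1..2 * Suc n - 1}. odd m} = insert (2 * n + 1) {m \<in> {1..2 * n - 1}. odd m}"
  proof (intro equalityI subsetI)
    fix m assume "m \<in> {m \<in> {1..2 * Suc n - 1}. odd m}"
    then show "m \<in> insert (2 * n + 1) {m \<in> {1..2 * n - 1}. odd m}"
      by (auto elim!: oddE)
  qed auto
  then have "(\<Sum>m\<in>{m\<in>{1..2 * Suc n - 1}. odd m}. harmonic m)
      = harmonic (Suc (2 * n)) + (\<Sum>m\<in>{m\<in>{1..2 * n - 1}. odd m}. harmonic m)"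
    by simp
  also have "\<dots> = harmonic (Suc (2 * n))
      + (of_nat n * harmonic (2 * n) - of_nat n + odd_harmonic (2 * n) / 2)"
    by (simp only: Suc.IH)
  finally have S: "(\<Sum>m\<in>{m\<in>{1..2 * Suc n - 1}. odd m}. harmonic m) = \<dots>" .
  \<comment> \<open>With the two new reciprocals named, the only products to be reduced are
    \<open>a * n\<close> and \<open>b * n\<close>. Both become linear through
    \<open>a (2 n + 1) = 1\<close> and \<open>b (2 n + 2) = 1\<close>.\<close>
  define a b :: rat where "a = 1 / of_nat (Suc (2 * n))" and "b = 1 / of_nat (Suc (Suc (2 * n)))"
  have "a * of_nat (Suc (2 * n)) = 1" "b * of_nat (Suc (Suc (2 * n))) = 1"
    by (simp_all only: a_def b_def nonzero_divide_eq_eq[symmetric] of_nat_neq_0 not_False_eq_True)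
      simp_all
  then have "a * of_nat n = (1 - a) / 2" "b * of_nat n = 1 / 2 - b"
    by (simp_all add: algebra_simps)
  moreover have "harmonic (Suc (2 * n)) = harmonic (2 * n) + a"
    "harmonic (2 * Suc n) = harmonic (2 * n) + a + b"
    "odd_harmonic (2 * Suc n) = odd_harmonic (2 * n) + a"
    by (simp_all only: mult_Suc_right add_2_eq_Suc harmonic_Suc odd_harmonic_Suc a_def b_def) simp
  ultimately show ?case
    unfolding S by (simp add: algebra_simps add_divide_distrib diff_divide_distrib)
qed

text \<open>Odd \<open>j\<close> carry the sign plus and even \<open>j\<close> the sign minus, so
  the sum is the odd part minus the even part, and the even part is
  \<open>harmonic m - odd_harmonic m\<close>.\<close>

lemma alternating_harmonic:
  "(\<Sum>j=1..m. (-1) ^ (j - 1) / of_nat j) = 2 * odd_harmonic m - harmonic m"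
proof (induction m)
  case 0
  show ?case by (simp add: odd_harmonic_def harmonic_def)
next
  case (Suc m)
  then show ?case by (simp add: odd_harmonic_Suc harmonic_Suc)
qed

section \<open>Sums of fractions with denominators below \<open>p\<close>\<close>

lemma padic_integral_sum_divide:
  assumes "prime p" "\<And>j. j \<in> {1..p - 1} \<Longrightarrow> padic_integral p (c j)"
  shows "padic_integral p (\<Sum>j=1..p - 1. c j / of_nat j)"
proof (rule padic_integral_sum[OF assms(1)])
  fix j assume j: "j \<in> {1..p - 1}"
  then have "\<not> p dvd j" using dvd_imp_le[of p j] prime_gt_0_nat[OF assms(1)] by auto
  from padic_integral_mult[OF assms(1) assms(2)[OF j] padic_integral_inverse_of_nat[OF this]]
  show "padic_integral p (c j / of_nat j)" by simp
qed

lemma harmonic_prime_minus_one: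
  assumes p: "prime p" "odd p"
  obtains z where "padic_integral p z" "harmonic (p - 1) = of_nat p * z"
proof
  \<comment> \<open>Since \<open>1 / j + 1 / (p - j) = p / (j (p - j))\<close>, adding the sum to
    its reversal gives \<open>2 H = p ?w\<close>. The cofactor of \<open>p\<close> in
    \<open>H\<close> is therefore \<open>?w / 2\<close>, integral because \<open>p\<close> is
    odd.\<close>
  let ?w = "\<Sum>j=1..p - 1. (1 / of_nat (p - j)) / of_nat j :: rat"
  have rev: "harmonic (p - 1) = (\<Sum>j=1..p - 1. 1 / of_nat (p - j))"
    unfolding harmonic_def by (rule sum.reindex_bij_witness[of _ "\<lambda>j. p - j" "\<lambda>j. p - j"]) auto
  have "2 * harmonic (p - 1) = (\<Sum>j=1..p - 1. 1 / of_nat j + 1 / of_nat (p - j))"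
    using rev by (simp add: sum.distrib harmonic_def)
  also have "\<dots> = (\<Sum>j=1..p - 1. of_nat p * ((1 / of_nat (p - j)) / of_nat j))"
  proof (rule sum.cong)
    fix j assume "j \<in> {1..p - 1}"
    then have "j > 0" "p - j > 0" "of_nat p = (of_nat j + of_nat (p - j) :: rat)"
      by (auto simp flip: of_nat_add)
    then show "1 / of_nat j + 1 / of_nat (p - j) = of_nat p * ((1 / of_nat (p - j)) / of_nat j :: rat)"
      by (simp add: field_simps)
  qed simp
  also have "\<dots> = of_nat p * ?w" by (simp add: sum_distrib_left)
  finally show "harmonic (p - 1) = of_nat p * (?w / 2)" by simp
  have "\<not> p dvd p - j" if "j \<in> {1..p - 1}" for j
    using that dvd_imp_le[of p "p - j"] by fastforce
  then show "padic_integral p (?w / 2)"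
    by (intro padic_integral_half[OF p] padic_integral_sum_divide[OF p(1)]
        padic_integral_inverse_of_nat)
qed

section \<open>Binomial coefficients and the Fermat quotient\<close>

lemma prime_minus_one_choose_cong:
  assumes "prime p" "k < p"
  shows "[int (p - 1 choose k) = (-1) ^ k] (mod int p)"
  using assms(2)
proof (induction k)
  case (Suc k)
  \<comment> \<open>By Pascal's rule two neighbours in row \<open>p - 1\<close> add up to an inner
    entry of row \<open>p\<close>, which \<open>p\<close> divides. Hence the sign alternates modulo
    \<open>p\<close>.\<close>
  have "p choose Suc k = (p - 1 choose k) + (p - 1 choose Suc k)"
    using choose_reduce_nat[of p "Suc k"] prime_gt_0_nat[OF assms(1)] by simp
  moreover have "p dvd p choose Suc k" using Suc.prems assms(1) by (intro dvd_choose_prime) auto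
  ultimately have "int p dvd int (p - 1 choose k) + int (p - 1 choose Suc k)"
    by (metis int_dvd_int_iff of_nat_add)
  moreover have "int p dvd int (p - 1 choose k) - (-1) ^ k"
    using Suc by (simp add: cong_iff_dvd_diff)
  ultimately have "int p dvd (int (p - 1 choose k) + int (p - 1 choose Suc k))
      - (int (p - 1 choose k) - (-1) ^ k)"
    by (rule dvd_diff)
  then show ?case by (simp add: cong_iff_dvd_diff algebra_simps)
qed simp

lemma double_fermat_quotient_2:
  assumes "prime p"
  shows "2 * fermat_quotient p 2 = (\<Sum>j=1..p - 1. of_nat (p - 1 choose (j - 1)) / of_nat j)"
proof -
  have p0: "p > 0" using assms by (rule prime_gt_0_nat)
  \<comment> \<open>The end terms \<open>j = 0\<close> and \<open>j = p\<close> of the row sum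
    contribute 1 each; the inner terms add up to \<open>2 ^ p - 2\<close>, which is
    \<open>2 p\<close> times the Fermat quotient.\<close>
  have "{..p} = insert 0 (insert p {1..p - 1})" using p0 by auto
  then have "(2 :: nat) ^ p = 2 + (\<Sum>j=1..p - 1. p choose j)"
    using choose_row_sum[of p] p0 by simp
  then have "(2 :: rat) ^ p = 2 + (\<Sum>j=1..p - 1. of_nat (p choose j))"
    by (metis of_nat_add of_nat_numeral of_nat_power of_nat_sum)
  moreover have "(2 :: rat) ^ p = 2 * 2 ^ (p - 1)"
    using p0 by (simp flip: power_Suc)
  ultimately have "2 * fermat_quotient p 2 = (\<Sum>j=1..p - 1. of_nat (p choose j) / of_nat p)"
    by (simp add: fermat_quotient_def flip: sum_divide_distrib)
  also have "\<dots> = (\<Sum>j=1..p - 1. of_nat (p - 1 choose (j - 1)) / of_nat j)"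
  proof (rule sum.cong)
    fix j assume "j \<in> {1..p - 1}"
    then have j: "j > 0" by simp
    \<comment> \<open>The absorption identity trades the denominator \<open>p\<close> for the unit
      \<open>j\<close>.\<close>
    have "of_nat (j * (p choose j)) = (of_nat (p * (p - 1 choose (j - 1))) :: rat)"
      using times_binomial_minus1_eq[OF j] by simp
    then show "of_nat (p choose j) / of_nat p = (of_nat (p - 1 choose (j - 1)) / of_nat j :: rat)"
      using j p0 by (simp add: field_simps)
  qed simp
  finally show ?thesis .
qed

lemma odd_harmonic_cong_fermat_quotient:
  assumes p: "prime p" "odd p"
  shows "padic_cong p (odd_harmonic (p - 1)) (fermat_quotient p 2)"
proof -
  let ?b = "\<lambda>j. p - 1 choose (j - 1)"
  \<comment> \<open>\<open>c j\<close> is the integer cofactor of \<open>p\<close> in the error made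
    by replacing the binomial coefficient by its sign; \<open>w\<close> collects these
    errors.\<close>
  define c where "c j = (int (?b j) - (-1) ^ (j - 1)) div int p" for j
  have c: "of_nat (?b j) - (-1) ^ (j - 1) = (of_nat p * of_int (c j) :: rat)"
    if "j \<in> {1..p - 1}" for j
  proof -
    have "int p dvd int (?b j) - (-1) ^ (j - 1)"
      using prime_minus_one_choose_cong[OF p(1), of "j - 1"] that by (auto simp: cong_iff_dvd_diff)
    then have "int (?b j) - (-1) ^ (j - 1) = int p * c j" by (simp add: c_def)
    then have "of_int (int (?b j) - (-1) ^ (j - 1)) = (of_int (int p * c j) :: rat)" by simp
    then show ?thesis by simp
  qed
  define w :: rat where "w = (\<Sum>j=1..p - 1. of_int (c j) / of_nat j)"
  have w: "padic_integral p w"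
    unfolding w_def by (intro padic_integral_sum_divide padic_integral_of_int p(1))
  obtain z where z: "padic_integral p z" "harmonic (p - 1) = of_nat p * z"
    using p by (rule harmonic_prime_minus_one)
  \<comment> \<open>Writing \<open>O\<close> for the odd part and \<open>q\<close> for the quotient,
    \<open>2 q - (2 O - H) = p w\<close> and \<open>H = p z\<close> give
    \<open>O - q = p (z - w) / 2\<close>.\<close>
  have "2 * fermat_quotient p 2 - (2 * odd_harmonic (p - 1) - harmonic (p - 1))
      = (\<Sum>j=1..p - 1. (of_nat (?b j) - (-1) ^ (j - 1)) / of_nat j)"
    by (simp only: double_fermat_quotient_2[OF p(1)] flip: alternating_harmonic)
      (simp add: sum_subtractf diff_divide_distrib)
  also have "\<dots> = (\<Sum>j=1..p - 1. of_nat p * (of_int (c j) / of_nat j))"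
    by (rule sum.cong[OF HOL.refl]) (simp only: c times_divide_eq_right)
  also have "\<dots> = of_nat p * w" by (simp add: w_def sum_distrib_left)
  finally have "odd_harmonic (p - 1) - fermat_quotient p 2 = of_nat p * ((z - w) / 2)"
    using z(2) by (simp add: field_simps)
  \<comment> \<open>The double of the quotient is a sum of integers divided by units
    \<open>j\<close>, and 2 is a unit too.\<close>
  moreover have "padic_integral p (fermat_quotient p 2)"
    using padic_integral_half[OF p padic_integral_sum_divide[OF p(1) padic_integral_of_nat[OF p(1)], of ?b]]
    by (simp only: nonzero_mult_div_cancel_left zero_neq_numeral[symmetric] not_False_eq_True
        flip: double_fermat_quotient_2[OF p(1)])
  ultimately show ?thesis
    using padic_congI[OF p(1) _ padic_integral_half[OF p padic_integral_diff[OF p(1) z(1) w]]] by blast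
qed

section \<open>The sum of harmonic numbers modulo \<open>p\<close>\<close>

lemma sum_harmonic_odd_cong:
  assumes p: "prime p" "odd p"
  shows "padic_cong p (\<Sum>m\<in>{m\<in>{1..p - 2}. odd m}. harmonic m) ((1 + odd_harmonic (p - 1)) / 2)"
proof -
  obtain n where n: "p = 2 * n + 1" using p(2) by (rule oddE)
  obtain z where z: "padic_integral p z" "harmonic (p - 1) = of_nat p * z"
    using p by (rule harmonic_prime_minus_one)
  have "p - 2 = 2 * n - 1" "p - 1 = 2 * n" using n by auto
  \<comment> \<open>In the difference the odd part cancels, and the constants combine to
    \<open>- n - 1 / 2 = - p / 2\<close>, a multiple of \<open>p\<close> because 2 is a
    unit.\<close>
  then have "(\<Sum>m\<in>{m\<in>{1..p - 2}. odd m}. harmonic m) - (1 + odd_harmonic (p - 1)) / 2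
      = of_nat n * harmonic (p - 1) - of_nat p / 2"
    by (simp only: sum_harmonic_odd) (simp add: n add_divide_distrib)
  also have "\<dots> = of_nat p * (of_nat n * z - 1 / 2)"
    unfolding z(2) by (simp add: algebra_simps)
  finally have "(\<Sum>m\<in>{m\<in>{1..p - 2}. odd m}. harmonic m) - (1 + odd_harmonic (p - 1)) / 2
      = of_nat p * (of_nat n * z - 1 / 2)" .
  moreover have "padic_integral p (of_nat n * z - 1 / 2)"
    using padic_integral_half[OF p padic_integral_of_nat[OF p(1), of 1]]
    by (intro padic_integral_diff padic_integral_mult padic_integral_of_nat p z) simp
  moreover have "padic_integral p ((1 + odd_harmonic (p - 1)) / 2)"
    using padic_cong_half_Suc[OF p odd_harmonic_cong_fermat_quotient[OF p]]
    by (simp add: padic_cong_def)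
  ultimately show ?thesis using padic_congI[OF p(1)] by blast
qed

theorem theorem11:
  fixes p :: nat
  assumes "prime p" and "odd p"
  shows "padic_cong p
           (\<Sum>m\<in>{m\<in>{1..p - 2}. odd m}. harmonic m)
           (1 / 2 * (1 + of_nat (padic_residue p (odd_harmonic (p - 1)))))
       \<and> padic_cong p
           (1 / 2 * (1 + of_nat (padic_residue p (odd_harmonic (p - 1)))))
           ((1 + fermat_quotient p 2) / 2)"
proof -
  let ?r = "of_nat (padic_residue p (odd_harmonic (p - 1))) :: rat"
  note q = odd_harmonic_cong_fermat_quotient[OF assms]
  \<comment> \<open>The residue is meaningful because the odd part is integral, which is contained
    in the congruence \<open>q\<close>.\<close>
  have r: "padic_cong p (odd_harmonic (p - 1)) ?r"
    using q by (intro padic_residue_cong assms(1)) (simp add: padic_cong_def)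
  have "padic_cong p (\<Sum>m\<in>{m\<in>{1..p - 2}. odd m}. harmonic m) ((1 + ?r) / 2)"
    using padic_cong_trans[OF assms(1) sum_harmonic_odd_cong[OF assms] padic_cong_half_Suc[OF assms r]] .
  \<comment> \<open>The odd part links both congruences: it is congruent to its residue by
    \<open>r\<close> and to the Fermat quotient by \<open>q\<close>.\<close>
  moreover have "padic_cong p ((1 + ?r) / 2) ((1 + fermat_quotient p 2) / 2)"
    using padic_cong_half_Suc[OF assms padic_cong_trans[OF assms(1) padic_cong_sym[OF assms(1) r] q]] .
  ultimately show ?thesis by simp
qed

end
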